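(* Let $g\colon\mathbb{R}^d\to\mathbb{R}$ be a function for which there exist reals $\rho,\mu>0$ such that: (1) the function $g+\frac{\rho}{2}\|\cdot\|^2$ is convex; (2) the set $\mathcal{X}$ of minimizers of $g$ is nonempty and $g(x)-\min g\ge\mu\cdot\mathrm{dist}(x;\mathcal{X})$ for all $x\in\mathbb{R}^d$. Fix a real $\gamma\in(0,1)$ and define the tube $$\mathcal{T}:=\left\{x\in\mathbb{R}^d:\mathrm{dist}(x;\mathcal{X})\le\gamma\cdot\frac{\mu}{\rho}\right\}$$ and the corresponding Lipschitz constant $$L_g:=\sup_{x\in\mathcal{T},\,\zeta\in\partial g(x)}\|\zeta\|.$$ Then the Polyak subgradient method for $g$ initialized at any point $x_0\in\mathcal{T}$ produces iterates that converge $Q$-linearly to $\mathcal{X}$ at the rate $$\mathrm{dist}^2(x_{k+1};\mathcal{X})\le\left(1-\frac{(1-\gamma)\mu^2}{L_g^2}\right)\mathrm{dist}^2(x_k;\mathcal{X}).$$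
   Context: Here $\|\cdot\|$ is the Euclidean norm and $\mathrm{dist}(x;\mathcal{X})=\inf_{y\in\mathcal{X}}\|y-x\|$. Limiting subdifferential: the Fréchet subdifferential $\hat\partial g(x)$ is the set of $v$ with $g(y)\ge g(x)+\langle v,y-x\rangle+o(\|y-x\|)$ as $y\to x$; the limiting subdifferential $\partial g(x)$ is the set of limits of vectors $v_i\in\hat\partial g(x_i)$ with $x_i\to x$, $g(x_i)\to g(x)$. Polyak subgradient method for $g$: given $x_0\in\mathbb{R}^d$, at step $k\ge0$ choose any $\zeta_k\in\partial g(x_k)$; if $\zeta_k\ne0$ set $x_{k+1}=x_k-\frac{g(x_k)-\min g}{\|\zeta_k\|^2}\zeta_k$, and otherwise exit the algorithm. The displayed rate is asserted for every $k$ for which $x_{k+1}$ is generated. *)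

theory Defs
  imports "HOL-Analysis.Analysis" "HOL-Library.Landau_Symbols"
begin

definition frechet_subdifferential :: "('a::euclidean_space \<Rightarrow> real) \<Rightarrow> 'a \<Rightarrow> 'a set" where
  "frechet_subdifferential g x =
     {v. \<exists>r \<in> o[at x](\<lambda>y. norm (y - x)).
           \<forall>\<^sub>F y in at x. g y \<ge> g x + v \<bullet> (y - x) + r y}"

definition limiting_subdifferential :: "('a::euclidean_space \<Rightarrow> real) \<Rightarrow> 'a \<Rightarrow> 'a set" where
  "limiting_subdifferential g x =
     {v. \<exists>xs vs. (\<forall>i::nat. vs i \<in> frechet_subdifferential g (xs i)) \<and>
           xs \<longlonglongrightarrow> x \<and> (\<lambda>i. g (xs i)) \<longlonglongrightarrow> g x \<and> vs \<longlonglongrightarrow> v}"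

definition minimizers :: "('a \<Rightarrow> real) \<Rightarrow> 'a set" where
  "minimizers g = {x. is_arg_min g (\<lambda>_. True) x}"

text \<open>The infimum is the minimum value only when a minimizer exists, as is assumed wherever
  this is used.\<close>

definition min_value :: "('a \<Rightarrow> real) \<Rightarrow> real" where
  "min_value g = (INF x. g x)"

definition tube :: "('a::euclidean_space \<Rightarrow> real) \<Rightarrow> real \<Rightarrow> real \<Rightarrow> real \<Rightarrow> 'a set" where
  "tube g \<rho> \<mu> \<gamma> = {x. infdist x (minimizers g) \<le> \<gamma> * (\<mu> / \<rho>)}"

text \<open>The supremum is extended-real-valued since it may be infinite when the set of minimizers is
  unbounded: for \<open>g (x, y) = max 0 (x\<^sup>2 - y)\<close>, subgradients are unbounded on every tube.\<close>

definition subgradient_bound :: "('a::euclidean_space \<Rightarrow> real) \<Rightarrow> 'a set \<Rightarrow> ereal" where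
  "subgradient_bound g T =
     Sup {ereal (norm \<zeta>) | x \<zeta>. x \<in> T \<and> \<zeta> \<in> limiting_subdifferential g x}"

text \<open>The iterate \<open>x k\<close> is generated iff the method has not exited before step \<open>k\<close>, that is, iff
  \<open>\<zeta> j \<noteq> 0\<close> for all \<open>j < k\<close>. The entries of the two sequences after an exit are unconstrained, so
  that both finite and infinite executions are represented by total sequences.\<close>

definition polyak_generated :: "(nat \<Rightarrow> 'a::euclidean_space) \<Rightarrow> nat \<Rightarrow> bool" where
  "polyak_generated \<zeta> k \<longleftrightarrow> (\<forall>j<k. \<zeta> j \<noteq> 0)"

definition polyak_method ::
    "('a::euclidean_space \<Rightarrow> real) \<Rightarrow> (nat \<Rightarrow> 'a) \<Rightarrow> (nat \<Rightarrow> 'a) \<Rightarrow> bool" where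
  "polyak_method g x \<zeta> \<longleftrightarrow>
     (\<forall>k. polyak_generated \<zeta> k \<longrightarrow>
        \<zeta> k \<in> limiting_subdifferential g (x k) \<and>
        (\<zeta> k \<noteq> 0 \<longrightarrow>
           x (Suc k) = x k - ((g (x k) - min_value g) / (norm (\<zeta> k))\<^sup>2) *\<^sub>R \<zeta> k))"

end

theory Submission
  imports Defs
begin

text \<open>
  Weak convexity upgrades every limiting subgradient \<open>v\<close> at \<open>x\<close> to the global estimate
  \<open>g y \<ge> g x + v \<bullet> (y - x) - \<rho> / 2 * (norm (y - x))\<^sup>2\<close>. With \<open>y\<close> a minimizer and
  \<open>\<Delta> = g x - min g\<close>, expanding the square gives, for the Polyak step \<open>x'\<close>,
  \<open>(norm (x' - y))\<^sup>2 \<le> (norm (x - y))\<^sup>2 - \<Delta> / (norm v)\<^sup>2 * (\<Delta> - \<rho> * (norm (x - y))\<^sup>2)\<close>.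
  Letting \<open>norm (x - y)\<close> tend to the distance \<open>d\<close> from \<open>x\<close> to the minimizers, sharpness
  \<open>\<Delta> \<ge> \<mu> * d\<close> and the tube condition \<open>\<rho> * d \<le> \<gamma> * \<mu>\<close> bound the decrease from below by
  \<open>(1 - \<gamma>) * \<mu>\<^sup>2 * d\<^sup>2 / (norm v)\<^sup>2\<close>. In particular the iterates never leave the tube.
\<close>

lemma norm_add_scaleR_squared:
  fixes a b :: "'a::real_inner"
  shows "(norm (a + t *\<^sub>R b))\<^sup>2 = (norm a)\<^sup>2 + 2 * t * (b \<bullet> a) + t\<^sup>2 * (norm b)\<^sup>2"
  unfolding dot_square_norm[symmetric]
  by (simp add: inner_add_left inner_add_right inner_commute power2_eq_square)

text \<open>The Frechet inequality is only local. On the segment from \<open>x\<close> to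
  \<open>y\<close>, convexity bounds the increment of \<open>g + \<rho> / 2 * norm\<^sup>2\<close>
  above by \<open>t\<close> times the full increment, while \<open>v\<close> bounds it below to
  first order in \<open>t\<close>. Dividing by \<open>t\<close> makes the estimate global.\<close>

lemma frechet_subgradient_weakly_convex:
  fixes g :: "'a::euclidean_space \<Rightarrow> real"
  assumes conv: "convex_on UNIV (\<lambda>y. g y + \<rho> / 2 * (norm y)\<^sup>2)"
    and "0 \<le> \<rho>"
    and v: "v \<in> frechet_subdifferential g x"
  shows "g y \<ge> g x + v \<bullet> (y - x) - \<rho> / 2 * (norm (y - x))\<^sup>2"
proof (cases "y = x")
  case True
  then show ?thesis by simp
next
  case False
  define n where "n = norm (y - x)"
  have n: "n > 0" using False by (simp add: n_def)
  obtain r where r: "r \<in> o[at x](\<lambda>y. norm (y - x))"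
    and ge: "\<forall>\<^sub>F y in at x. g y \<ge> g x + v \<bullet> (y - x) + r y"
    using v unfolding frechet_subdifferential_def by blast
  let ?G = "\<lambda>y. g y + \<rho> / 2 * (norm y)\<^sup>2"
  \<comment> \<open>The left side pairs \<open>v + \<rho> *\<^sub>R x\<close>, the corresponding
    subgradient of \<open>?G\<close> at \<open>x\<close>, with \<open>y - x\<close>; \<epsilon>
    absorbs the remainder \<open>r\<close>.\<close>
  have main: "v \<bullet> (y - x) + \<rho> * (x \<bullet> (y - x)) \<le> ?G y - ?G x + \<epsilon>" if "\<epsilon> > 0" for \<epsilon>
  proof -
    \<comment> \<open>With tolerance \<open>\<epsilon> / n\<close>, the error at distance
      \<open>t * n\<close> is \<open>\<epsilon> * t\<close>, which becomes \<epsilon> after division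
      by \<open>t\<close>.\<close>
    have "\<forall>\<^sub>F z in at x. norm (r z) \<le> (\<epsilon> / n) * norm (norm (z - x))"
      by (rule landau_o.smallD[OF r]) (use that n in simp)
    with ge have "\<forall>\<^sub>F z in at x. g z \<ge> g x + v \<bullet> (z - x) - (\<epsilon> / n) * norm (z - x)"
      by eventually_elim (auto simp: abs_le_iff)
    then obtain \<delta> where \<delta>: "\<delta> > 0"
      and near: "\<And>z. z \<noteq> x \<Longrightarrow> dist z x < \<delta> \<Longrightarrow> g z \<ge> g x + v \<bullet> (z - x) - (\<epsilon> / n) * norm (z - x)"
      unfolding eventually_at by auto
    \<comment> \<open>The cap 1 keeps \<open>z\<close> on the segment; the other bound gives
      \<open>t * n \<le> \<delta> / 2\<close>, inside the neighbourhood.\<close>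
    define t where "t = min 1 (\<delta> / (2 * n))"
    define z where "z = x + t *\<^sub>R (y - x)"
    have t: "0 < t" "t \<le> 1" "t * n < \<delta>"
      using \<delta> n by (auto simp: t_def min_def field_simps)
    have nz: "norm (z - x) = t * n" using t by (simp add: z_def n_def)
    have "z \<noteq> x" using t False by (simp add: z_def)
    moreover have "dist z x < \<delta>" using nz t by (simp add: dist_norm)
    ultimately have "g z \<ge> g x + v \<bullet> (z - x) - (\<epsilon> / n) * (t * n)"
      using near[of z] nz by simp
    moreover have "v \<bullet> (z - x) = t * (v \<bullet> (y - x))" by (simp add: z_def)
    ultimately have gz: "g z \<ge> g x + t * (v \<bullet> (y - x)) - \<epsilon> * t"
      using n by simp
    have "z = (1 - t) *\<^sub>R x + t *\<^sub>R y" by (simp add: z_def algebra_simps)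
    then have Gz: "?G z \<le> (1 - t) * ?G x + t * ?G y"
      using convex_onD[OF conv, of t x y] t by simp
    have "(norm z)\<^sup>2 = (norm x)\<^sup>2 + 2 * t * (x \<bullet> (y - x)) + t\<^sup>2 * (norm (y - x))\<^sup>2"
      unfolding z_def norm_add_scaleR_squared by (simp add: inner_commute)
    then have "(norm z)\<^sup>2 \<ge> (norm x)\<^sup>2 + 2 * t * (x \<bullet> (y - x))" by simp
    then have "\<rho> / 2 * (norm z)\<^sup>2 \<ge> \<rho> / 2 * ((norm x)\<^sup>2 + 2 * t * (x \<bullet> (y - x)))"
      using \<open>0 \<le> \<rho>\<close> by (intro mult_left_mono) auto
    with gz Gz have "t * (v \<bullet> (y - x) + \<rho> * (x \<bullet> (y - x))) \<le> t * (?G y - ?G x + \<epsilon>)"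
      by (simp add: algebra_simps diff_divide_distrib)
    then show ?thesis using t(1) by simp
  qed
  have "v \<bullet> (y - x) + \<rho> * (x \<bullet> (y - x)) \<le> ?G y - ?G x"
    by (rule field_le_epsilon) (rule main)
  \<comment> \<open>Completing the square turns the subgradient inequality for \<open>?G\<close>
    into the quadratic lower bound for \<open>g\<close>.\<close>
  moreover have "\<rho> / 2 * (norm (y - x))\<^sup>2
      = \<rho> / 2 * (norm y)\<^sup>2 - \<rho> / 2 * (norm x)\<^sup>2 - \<rho> * (x \<bullet> (y - x))"
    unfolding power2_norm_eq_inner
    by (simp add: algebra_simps inner_commute)
  ultimately show ?thesis by linarith
qed

text \<open>The Frechet estimate holds for every \<open>y\<close> with the same \<rho> along the
  approximating sequence, so it passes to the limit; convergence of \<open>g (xs i)\<close> handles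
  the value term.\<close>

lemma limiting_subgradient_weakly_convex:
  fixes g :: "'a::euclidean_space \<Rightarrow> real"
  assumes conv: "convex_on UNIV (\<lambda>y. g y + \<rho> / 2 * (norm y)\<^sup>2)"
    and "0 \<le> \<rho>"
    and v: "v \<in> limiting_subdifferential g x"
  shows "g y \<ge> g x + v \<bullet> (y - x) - \<rho> / 2 * (norm (y - x))\<^sup>2"
proof -
  obtain xs vs where vs: "\<And>i::nat. vs i \<in> frechet_subdifferential g (xs i)"
    and lims: "xs \<longlonglongrightarrow> x" "(\<lambda>i. g (xs i)) \<longlonglongrightarrow> g x" "vs \<longlonglongrightarrow> v"
    using v unfolding limiting_subdifferential_def by blast
  have "(\<lambda>i. g (xs i) + vs i \<bullet> (y - xs i) - \<rho> / 2 * (norm (y - xs i))\<^sup>2)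
      \<longlonglongrightarrow> g x + v \<bullet> (y - x) - \<rho> / 2 * (norm (y - x))\<^sup>2"
    by (intro tendsto_intros lims)
  then show ?thesis
    by (rule LIMSEQ_le_const2)
       (use frechet_subgradient_weakly_convex[OF conv \<open>0 \<le> \<rho>\<close> vs] in blast)
qed

lemma min_value_eq:
  assumes "y \<in> minimizers g"
  shows "min_value g = g y"
  using assms unfolding min_value_def minimizers_def is_arg_min_linorder
  by (auto intro!: cInf_eq_minimum)

text \<open>A minimizing sequence stands in for a nearest point: the one-step estimate is proved for
  each minimizer and then taken to the limit along it.\<close>

lemma infdist_approx:
  assumes "A \<noteq> {}"
  obtains y where "\<And>i::nat. y i \<in> A" "(\<lambda>i. dist x (y i)) \<longlonglongrightarrow> infdist x A"
proof -
  have "\<exists>y\<in>A. dist x y < infdist x A + 1 / real (Suc i)" for i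
    using assms cInf_lessD[of "dist x ` A" "infdist x A + 1 / real (Suc i)"]
    by (auto simp: infdist_def)
  then have "\<forall>i. \<exists>y. y \<in> A \<and> dist x y < infdist x A + 1 / real (Suc i)" by blast
  from choice[OF this]
  obtain y where y: "\<And>i. y i \<in> A" "\<And>i. dist x (y i) < infdist x A + 1 / real (Suc i)"
    by blast
  have "(\<lambda>i. infdist x A + 1 / real (Suc i)) \<longlonglongrightarrow> infdist x A + 0"
    by (intro tendsto_add tendsto_const LIMSEQ_Suc lim_1_over_n)
  then have "(\<lambda>i. dist x (y i)) \<longlonglongrightarrow> infdist x A + 0"
  proof (rule tendsto_sandwich[rotated 3])
    show "(\<lambda>i. infdist x A) \<longlonglongrightarrow> infdist x A + 0" by simp
    show "\<forall>\<^sub>F i in sequentially. infdist x A \<le> dist x (y i)"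
      using y(1) by (intro always_eventually allI infdist_le)
    show "\<forall>\<^sub>F i in sequentially. dist x (y i) \<le> infdist x A + 1 / real (Suc i)"
      using y(2) by (intro always_eventually allI less_imp_le)
  qed
  then have "(\<lambda>i. dist x (y i)) \<longlonglongrightarrow> infdist x A" by simp
  with y(1) show thesis by (rule that)
qed

text \<open>The rate involves the norm of the chosen subgradient, so the whole estimate stays in the
  reals; the possibly infinite supremum enters only in the final theorem.\<close>

lemma polyak_step_contraction:
  fixes g :: "'a::euclidean_space \<Rightarrow> real"
  assumes conv: "convex_on UNIV (\<lambda>y. g y + \<rho> / 2 * (norm y)\<^sup>2)"
    and "\<rho> > 0" and "\<mu> \<ge> 0" and "\<gamma> \<le> 1"
    and nonempty: "minimizers g \<noteq> {}"
    and sharp: "g x - min_value g \<ge> \<mu> * infdist x (minimizers g)"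
    and tube: "x \<in> tube g \<rho> \<mu> \<gamma>"
    and v: "v \<in> limiting_subdifferential g x" "v \<noteq> 0"
  defines "x' \<equiv> x - ((g x - min_value g) / (norm v)\<^sup>2) *\<^sub>R v"
  shows "(infdist x' (minimizers g))\<^sup>2
      \<le> (1 - (1 - \<gamma>) * \<mu>\<^sup>2 / (norm v)\<^sup>2) * (infdist x (minimizers g))\<^sup>2"
proof -
  define d where "d = infdist x (minimizers g)"
  define \<Delta> where "\<Delta> = g x - min_value g"
  define N where "N = (norm v)\<^sup>2"
  have N: "N > 0" using v by (simp add: N_def)
  have d: "d \<ge> 0" by (simp add: d_def infdist_nonneg)
  have \<Delta>: "\<Delta> \<ge> \<mu> * d" "\<Delta> \<ge> 0"
    using sharp d \<open>\<mu> \<ge> 0\<close> mult_nonneg_nonneg[of \<mu> d] unfolding \<Delta>_def d_def by linarith+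
  have step: "(infdist x' (minimizers g))\<^sup>2 \<le> (dist x y)\<^sup>2 - \<Delta> / N * (\<Delta> - \<rho> * (dist x y)\<^sup>2)"
    if y: "y \<in> minimizers g" for y
  proof -
    have "\<Delta> - \<rho> / 2 * (dist x y)\<^sup>2 \<le> v \<bullet> (x - y)"
      using limiting_subgradient_weakly_convex[OF conv less_imp_le[OF \<open>\<rho> > 0\<close>] v(1), of y]
        min_value_eq[OF y]
      by (simp add: \<Delta>_def dist_norm norm_minus_commute inner_diff_right)
    \<comment> \<open>The factor is twice the coefficient of \<open>v\<close> in the Polyak step,
      matching the cross term of \<open>(dist x' y)\<^sup>2\<close>.\<close>
    then have "2 * (\<Delta> / N) * (\<Delta> - \<rho> / 2 * (dist x y)\<^sup>2) \<le> 2 * (\<Delta> / N) * (v \<bullet> (x - y))"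
      using \<Delta> N by (intro mult_left_mono) auto
    moreover have "(dist x' y)\<^sup>2 = (dist x y)\<^sup>2 - 2 * (\<Delta> / N) * (v \<bullet> (x - y)) + (\<Delta> / N)\<^sup>2 * N"
    proof -
      have "x' - y = (x - y) + (- (\<Delta> / N)) *\<^sub>R v" by (simp add: x'_def \<Delta>_def N_def)
      then show ?thesis
        unfolding dist_norm N_def by (simp only: norm_add_scaleR_squared) simp
    qed
    moreover have "(\<Delta> / N)\<^sup>2 * N = \<Delta> / N * \<Delta>"
      using N by (simp add: power2_eq_square)
    ultimately have "(dist x' y)\<^sup>2 \<le> (dist x y)\<^sup>2 - \<Delta> / N * (\<Delta> - \<rho> * (dist x y)\<^sup>2)"
      by (simp add: right_diff_distrib)
    moreover have "(infdist x' (minimizers g))\<^sup>2 \<le> (dist x' y)\<^sup>2"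
      by (intro power_mono infdist_le y infdist_nonneg)
    ultimately show ?thesis by linarith
  qed
  obtain y where y: "\<And>i::nat. y i \<in> minimizers g" and lim: "(\<lambda>i. dist x (y i)) \<longlonglongrightarrow> d"
    using infdist_approx[OF nonempty] unfolding d_def by blast
  have "(\<lambda>i. (dist x (y i))\<^sup>2 - \<Delta> / N * (\<Delta> - \<rho> * (dist x (y i))\<^sup>2))
      \<longlonglongrightarrow> d\<^sup>2 - \<Delta> / N * (\<Delta> - \<rho> * d\<^sup>2)"
    by (intro tendsto_intros lim)
  then have descent: "(infdist x' (minimizers g))\<^sup>2 \<le> d\<^sup>2 - \<Delta> / N * (\<Delta> - \<rho> * d\<^sup>2)"
    by (rule LIMSEQ_le_const) (use step y in blast)
  have "\<rho> * d \<le> \<gamma> * \<mu>"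
    using tube \<open>\<rho> > 0\<close> by (simp add: tube_def d_def field_simps)
  \<comment> \<open>Multiplying by \<open>d\<close> makes the curvature loss
    \<open>\<rho> * d\<^sup>2\<close> at most a \<gamma> fraction of the sharpness bound
    \<open>\<mu> * d\<close>.\<close>
  then have "\<rho> * d * d \<le> \<gamma> * \<mu> * d" using d by (rule mult_right_mono)
  then have "(1 - \<gamma>) * (\<mu> * d) \<le> \<Delta> - \<rho> * d\<^sup>2"
    using \<Delta> by (simp add: algebra_simps power2_eq_square)
  \<comment> \<open>Sharpness is used twice, once for each factor; \<open>\<gamma> \<le> 1\<close>
    keeps the smaller second factor nonnegative.\<close>
  then have "\<mu> * d * ((1 - \<gamma>) * (\<mu> * d)) \<le> \<Delta> * (\<Delta> - \<rho> * d\<^sup>2)"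
    using \<Delta> d \<open>\<mu> \<ge> 0\<close> \<open>\<gamma> \<le> 1\<close> by (intro mult_mono) auto
  then have "(1 - \<gamma>) * \<mu>\<^sup>2 * d\<^sup>2 \<le> \<Delta> * (\<Delta> - \<rho> * d\<^sup>2)"
    by (simp add: power2_eq_square mult_ac)
  then have "(1 - \<gamma>) * \<mu>\<^sup>2 * d\<^sup>2 / N \<le> \<Delta> * (\<Delta> - \<rho> * d\<^sup>2) / N"
    using N by (intro divide_right_mono) auto
  with descent show ?thesis
    unfolding d_def[symmetric] N_def[symmetric] by (simp add: left_diff_distrib)
qed

lemma norm_le_subgradient_bound:
  assumes "x \<in> T" "v \<in> limiting_subdifferential g x"
  shows "ereal (norm v) \<le> subgradient_bound g T"
  unfolding subgradient_bound_def using assms by (intro Sup_upper) blast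

text \<open>For finite \<open>L\<close> this is antitonicity of \<open>c / s\<^sup>2\<close> in
  positive \<open>s\<close>; for infinite \<open>L\<close> the quotient is 0 and the right side is
  1.\<close>

lemma ereal_one_minus_divide_square_mono:
  assumes "0 \<le> c" "0 < s" "ereal s \<le> L"
  shows "ereal (1 - c / s\<^sup>2) \<le> 1 - ereal c / L\<^sup>2"
proof (cases L)
  case (real l)
  with assms have "0 < s" "s \<le> l" by auto
  then have "c / l\<^sup>2 \<le> c / s\<^sup>2"
    using assms by (intro divide_left_mono power_mono) auto
  with real \<open>0 < s\<close> \<open>s \<le> l\<close> show ?thesis
    by (simp add: one_ereal_def)
next
  case PInf
  with assms show ?thesis by (simp add: one_ereal_def)
next
  case MInf
  with assms show ?thesis by simp
qed

theorem theorem3p2: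
  fixes g :: "real ^ 'n \<Rightarrow> real"
    and \<rho> \<mu> \<gamma> :: real
    and x \<zeta> :: "nat \<Rightarrow> real ^ 'n"
  defines "T \<equiv> tube g \<rho> \<mu> \<gamma>"
    and "L \<equiv> subgradient_bound g (tube g \<rho> \<mu> \<gamma>)"
  assumes "\<rho> > 0" and "\<mu> > 0"
    and "convex_on UNIV (\<lambda>y. g y + \<rho> / 2 * (norm y)\<^sup>2)"
    and "minimizers g \<noteq> {}"
    and "\<And>y. g y - min_value g \<ge> \<mu> * infdist y (minimizers g)"
    and "0 < \<gamma>" and "\<gamma> < 1"
    and "polyak_method g x \<zeta>"
    and "x 0 \<in> T"
  shows "\<forall>k. polyak_generated \<zeta> (Suc k) \<longrightarrow>
           ereal ((infdist (x (Suc k)) (minimizers g))\<^sup>2)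
             \<le> (1 - ereal ((1 - \<gamma>) * \<mu>\<^sup>2) / L\<^sup>2) * ereal ((infdist (x k) (minimizers g))\<^sup>2)"
proof -
  let ?d = "\<lambda>k. infdist (x k) (minimizers g)"
  have step: "\<zeta> k \<in> limiting_subdifferential g (x k) \<and>
      (?d (Suc k))\<^sup>2 \<le> (1 - (1 - \<gamma>) * \<mu>\<^sup>2 / (norm (\<zeta> k))\<^sup>2) * (?d k)\<^sup>2"
    if "polyak_generated \<zeta> (Suc k)" "x k \<in> T" for k
  proof -
    have nz: "\<zeta> k \<noteq> 0" and "polyak_generated \<zeta> k"
      using that(1) by (auto simp: polyak_generated_def)
    then have "\<zeta> k \<in> limiting_subdifferential g (x k)"
      and "x (Suc k) = x k - ((g (x k) - min_value g) / (norm (\<zeta> k))\<^sup>2) *\<^sub>R \<zeta> k"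
      using assms(10) by (auto simp: polyak_method_def)
    with polyak_step_contraction[OF assms(5,3) _ _ assms(6,7), of \<gamma> "x k" "\<zeta> k"] nz that(2)
    show ?thesis using assms(4,9) by (simp add: T_def)
  qed
  \<comment> \<open>The contraction factor is at most 1 because \<open>\<gamma> < 1\<close>, so
    distances do not increase and the tube hypothesis of \<open>step\<close> propagates.\<close>
  have in_tube: "x k \<in> T" if "polyak_generated \<zeta> k" for k
    using that
  proof (induction k)
    case 0
    show ?case by (rule assms(11))
  next
    case (Suc k)
    then have k: "x k \<in> T" by (auto simp: polyak_generated_def)
    have "0 \<le> (1 - \<gamma>) * \<mu>\<^sup>2 / (norm (\<zeta> k))\<^sup>2" using assms(9) by simp
    then have "(1 - (1 - \<gamma>) * \<mu>\<^sup>2 / (norm (\<zeta> k))\<^sup>2) * (?d k)\<^sup>2 \<le> 1 * (?d k)\<^sup>2"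
      by (intro mult_right_mono) auto
    with step[OF Suc.prems k] have "(?d (Suc k))\<^sup>2 \<le> (?d k)\<^sup>2" by linarith
    then have "?d (Suc k) \<le> ?d k" by (rule power2_le_imp_le) (rule infdist_nonneg)
    with k show ?case by (simp add: T_def tube_def)
  qed
  show ?thesis
  proof (intro allI impI)
    fix k
    assume gen: "polyak_generated \<zeta> (Suc k)"
    then have k: "x k \<in> T" and nz: "\<zeta> k \<noteq> 0"
      using in_tube[of k] by (auto simp: polyak_generated_def)
    note s = step[OF gen k]
    have "ereal (norm (\<zeta> k)) \<le> L"
      using s k unfolding L_def T_def by (intro norm_le_subgradient_bound) auto
    \<comment> \<open>Positivity of \<open>norm (\<zeta> k)\<close> comes from generation of
      \<open>x (Suc k)\<close>, which excludes an exit at step \<open>k\<close>.\<close>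
    then have bound: "ereal (1 - (1 - \<gamma>) * \<mu>\<^sup>2 / (norm (\<zeta> k))\<^sup>2) \<le> 1 - ereal ((1 - \<gamma>) * \<mu>\<^sup>2) / L\<^sup>2"
      using nz assms(9) by (intro ereal_one_minus_divide_square_mono) auto
    have "ereal ((?d (Suc k))\<^sup>2)
        \<le> ereal (1 - (1 - \<gamma>) * \<mu>\<^sup>2 / (norm (\<zeta> k))\<^sup>2) * ereal ((?d k)\<^sup>2)"
      using s by (simp only: times_ereal.simps ereal_less_eq)
    also have "\<dots> \<le> (1 - ereal ((1 - \<gamma>) * \<mu>\<^sup>2) / L\<^sup>2) * ereal ((?d k)\<^sup>2)"
      using bound by (rule ereal_mult_right_mono) simp
    finally show "ereal ((?d (Suc k))\<^sup>2)
        \<le> (1 - ereal ((1 - \<gamma>) * \<mu>\<^sup>2) / L\<^sup>2) * ereal ((?d k)\<^sup>2)" .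
  qed
qed

end
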